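(* Assume that $b$, $f$ are $\mathbb{F}$-progressively measurable and bounded, and $\xi$ is $\mathcal{F}_T$-measurable and bounded. Let $(t,\omega)\in[0,T]\times\Omega$. Then: (i) for every $\varepsilon>0$, $\mathbb{V}_\varepsilon(t,\omega)$ is bounded and open in $\mathbb{R}^N$; (ii) for any $0<\varepsilon'<\varepsilon$, the closure satisfies $\mathrm{cl}(\mathbb{V}_{\varepsilon'}(t,\omega))\subset\mathbb{V}_\varepsilon(t,\omega)$; (iii) $\mathbb{V}(t,\omega)$ is compact; moreover $\mathbb{V}(t,\omega)\ne\emptyset$ whenever $NE_\varepsilon(t,\omega)\ne\emptyset$ for all $\varepsilon>0$.
   Context: Continuous-time game on canonical space. $\Omega=\{\omega\in C([0,T];\mathbb{R}^d):\omega_0=0\}$, $B_t(\omega)=\omega_t$ the canonical process, $\mathbb{P}_0$ the Wiener measure, $\mathbb{F}=\{\mathcal{F}_t\}_{0\le t\le T}$ the $\mathbb{P}_0$-augmented filtration generated by $B$. There are $N$ players; $A=A_1\times\cdots\times A_N$ is a convex domain in a Euclidean space; $\mathcal{A}=\mathcal{A}_1\times\cdots\times\mathcal{A}_N$ is the set of $\mathbb{F}$-progressively measurable $A$-valued processes. Data: $(b,f):[0,T]\times\Omega\times A\to\mathbb{R}^d\times\mathbb{R}^N$ (jointly measurable in $a$ as well), where $f_i$ depends on $a$ only through $a_i\in A_i$, and $\xi:\Omega\to\mathbb{R}^N$. Concatenation: $(\omega\otimes_t\tilde\omega)_s=\omega_s$ for $s\in[0,t]$ and $=\omega_t+\tilde\omega_{s-t}$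 for $s\in[t,T]$. Shifts: $\xi^{t,\omega}(\tilde\omega)=\xi(\omega\otimes_t\tilde\omega)$, and $b^{t,\omega}(s,\tilde\omega,a)=b(t+s,\omega\otimes_t\tilde\omega,a)$, similarly $f^{t,\omega}_i$. For $(t,\omega)\in[0,T]\times\Omega$ and $\alpha\in\mathcal{A}$ define $\frac{d\mathbb{P}^{t,\omega,\alpha}}{d\mathbb{P}_0}=\exp\big(\int_0^{T-t}b^{t,\omega}(s,B,\alpha_s)\cdot dB_s-\frac12\int_0^{T-t}|b^{t,\omega}(s,B,\alpha_s)|^2ds\big)$ and $J_i(t,\omega,\alpha)=\mathbb{E}^{\mathbb{P}^{t,\omega,\alpha}}\big[\xi_i^{t,\omega}(B)+\int_0^{T-t}f_i^{t,\omega}(s,B,\alpha^i_s)ds\big]$, $J=(J_1,\dots,J_N)$. For $\varepsilon>0$, $\alpha^\varepsilon\in\mathcal{A}$ is an $\varepsilon$-equilibrium at $(t,\omega)$, written $\alpha^\varepsilon\in NE_\varepsilon(t,\omega)$, if $J_i(t,\omega,\alpha^\varepsilon)\le J_i(t,\omega,\alpha^{\varepsilon,-i},\alpha^i)+\varepsilon$ for all $i$ and all $\alpha^i\in\mathcal{A}_i$, where $(\alpha^{\varepsilon,-i},\alpha^i)$ is $\alpha^\varepsilon$ with $i$-th component replaced by $\alpha^i$. With $O_\varepsilon(y)=\{\tilde y\in\mathbb{R}^N:|\tilde y-y|<\varepsilon\}$, define $\mathbb{V}_\varepsilon(t,\omega)=\bigcup_{\alpha^\varepsilon\in NE_\varepsilon(t,\omega)}O_\varepsilon(J(t,\omega,\alpha^\varepsilon))$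 and $\mathbb{V}(t,\omega)=\bigcap_{\varepsilon>0}\mathbb{V}_\varepsilon(t,\omega)$. *)

theory Defs
  imports "HOL-Probability.Probability"
begin

type_synonym 'd path = "real \<Rightarrow> real ^ 'd"

(* Extensionality outside [0,T] makes this a faithful copy of
   {w in C([0,T]; R^d). w_0 = 0} inside the type of all functions on the reals. *)
definition path_space :: "real \<Rightarrow> ('d::finite) path set" where
  "path_space T = {\<omega> \<in> extensional {0..T}. continuous_on {0..T} \<omega> \<and> \<omega> 0 = 0}"

definition raw_filt :: "real \<Rightarrow> real \<Rightarrow> ('d::finite) path measure" where
  "raw_filt T t = sigma (path_space T)
     {(\<lambda>\<omega>. \<omega> s) -` S \<inter> path_space T | s S. s \<in> {0..t} \<and> S \<in> sets borel}"

definition wiener_measure :: "real \<Rightarrow> ('d::finite) path measure \<Rightarrow> bool" where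
  "wiener_measure T P \<longleftrightarrow>
     prob_space P \<and> sets P = sets (raw_filt T T) \<and>
     (\<forall>s t. 0 \<le> s \<and> s < t \<and> t \<le> T \<longrightarrow>
        distributed P lborel (\<lambda>\<omega>. \<omega> t - \<omega> s)
          (\<lambda>x. ennreal (\<Prod>j\<in>UNIV. normal_density 0 (sqrt (t - s)) (x $ j))) \<and>
        prob_space.indep_set P (sets (raw_filt T s))
          {(\<lambda>\<omega>. \<omega> t - \<omega> s) -` S \<inter> path_space T | S. S \<in> sets borel})"

(* Here P lives on the raw sigma-algebra; completion P is its extension to the augmented one. *)
definition aug_filt :: "real \<Rightarrow> ('d::finite) path measure \<Rightarrow> real \<Rightarrow> 'd path measure" where
  "aug_filt T P t = sigma (path_space T) (sets (raw_filt T t) \<union> null_sets (completion P))"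

definition progressive ::
    "real \<Rightarrow> (real \<Rightarrow> 'w measure) \<Rightarrow> 'x measure \<Rightarrow> (real \<Rightarrow> 'w \<Rightarrow> 'x) \<Rightarrow> bool" where
  "progressive u F M X \<longleftrightarrow>
     (\<forall>t\<in>{0..u}. (\<lambda>(s, \<omega>). X s \<omega>) \<in> restrict_space borel {0..t} \<Otimes>\<^sub>M F t \<rightarrow>\<^sub>M M)"

definition progressive_param ::
    "real \<Rightarrow> (real \<Rightarrow> 'w measure) \<Rightarrow> 'a::topological_space set \<Rightarrow> 'x measure \<Rightarrow>
     (real \<Rightarrow> 'w \<Rightarrow> 'a \<Rightarrow> 'x) \<Rightarrow> bool" where
  "progressive_param u F A M X \<longleftrightarrow>
     (\<forall>t\<in>{0..u}. (\<lambda>(s, \<omega>, a). X s \<omega> a)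
        \<in> restrict_space borel {0..t} \<Otimes>\<^sub>M F t \<Otimes>\<^sub>M restrict_space borel A \<rightarrow>\<^sub>M M)"

(* The data (m, \<tau>, \<eta>) describe the simple process
   \<Sum>k<m. \<eta> k * 1_(\<tau> k, \<tau> (k+1)] on [0,u]. *)
definition simple_data ::
    "real \<Rightarrow> ('d::finite) path measure \<Rightarrow> real \<Rightarrow>
     nat \<Rightarrow> (nat \<Rightarrow> real) \<Rightarrow> (nat \<Rightarrow> 'd path \<Rightarrow> real ^ 'd) \<Rightarrow> bool" where
  "simple_data T P u m \<tau> \<eta> \<longleftrightarrow>
     \<tau> 0 = 0 \<and> \<tau> m = u \<and> (\<forall>k<m. \<tau> k \<le> \<tau> (Suc k)) \<and>
     (\<forall>k<m. \<eta> k \<in> borel_measurable (aug_filt T P (\<tau> k)) \<and> bounded (\<eta> k ` path_space T))"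

definition simple_process ::
    "nat \<Rightarrow> (nat \<Rightarrow> real) \<Rightarrow> (nat \<Rightarrow> ('d::finite) path \<Rightarrow> real ^ 'd) \<Rightarrow>
     real \<Rightarrow> 'd path \<Rightarrow> real ^ 'd" where
  "simple_process m \<tau> \<eta> s \<omega> = (\<Sum>k<m. indicator {\<tau> k<..\<tau> (Suc k)} s *\<^sub>R \<eta> k \<omega>)"

definition simple_integral ::
    "nat \<Rightarrow> (nat \<Rightarrow> real) \<Rightarrow> (nat \<Rightarrow> ('d::finite) path \<Rightarrow> real ^ 'd) \<Rightarrow> 'd path \<Rightarrow> real" where
  "simple_integral m \<tau> \<eta> \<omega> = (\<Sum>k<m. \<eta> k \<omega> \<bullet> (\<omega> (\<tau> (Suc k)) - \<omega> (\<tau> k)))"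

(* I is a version of the Ito integral of H . dB over [0,u]: H is progressively measurable and is
   the L^2(dt x dP)-limit of simple processes whose elementary integrals converge to I in L^2(P). *)
definition is_ito_integral ::
    "real \<Rightarrow> ('d::finite) path measure \<Rightarrow> real \<Rightarrow> (real \<Rightarrow> 'd path \<Rightarrow> real ^ 'd) \<Rightarrow>
     ('d path \<Rightarrow> real) \<Rightarrow> bool" where
  "is_ito_integral T P u H I \<longleftrightarrow>
     progressive u (aug_filt T P) borel H \<and> I \<in> borel_measurable (aug_filt T P u) \<and>
     (\<exists>m \<tau> \<eta>. (\<forall>n. simple_data T P u (m n) (\<tau> n) (\<eta> n)) \<and>
        (\<lambda>n. \<integral>\<^sup>+\<omega>. (\<integral>\<^sup>+s\<in>{0..u}.
             ennreal ((norm (H s \<omega> - simple_process (m n) (\<tau> n) (\<eta> n) s \<omega>))\<^sup>2) \<partial>lborel)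
           \<partial>completion P) \<longlonglongrightarrow> 0 \<and>
        (\<lambda>n. \<integral>\<^sup>+\<omega>. ennreal ((I \<omega> - simple_integral (m n) (\<tau> n) (\<eta> n) \<omega>)\<^sup>2)
           \<partial>completion P) \<longlonglongrightarrow> 0)"

(* The integral is determined up to P-null sets; we fix a version.  As for the library's
   integrals, the value is 0 if H has no integral (is not progressive and square-integrable). *)
definition ito_integral ::
    "real \<Rightarrow> ('d::finite) path measure \<Rightarrow> real \<Rightarrow> (real \<Rightarrow> 'd path \<Rightarrow> real ^ 'd) \<Rightarrow>
     'd path \<Rightarrow> real" where
  "ito_integral T P u H =
     (if \<exists>I. is_ito_integral T P u H I then SOME I. is_ito_integral T P u H I else (\<lambda>_. 0))"

definition concat_path ::
    "real \<Rightarrow> real \<Rightarrow> ('d::finite) path \<Rightarrow> 'd path \<Rightarrow> 'd path" where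
  "concat_path T t \<omega> \<omega>' = restrict (\<lambda>s. if s \<le> t then \<omega> s else \<omega> t + \<omega>' (s - t)) {0..T}"

definition shift_rv ::
    "real \<Rightarrow> real \<Rightarrow> ('d::finite) path \<Rightarrow> ('d path \<Rightarrow> 'x) \<Rightarrow> 'd path \<Rightarrow> 'x" where
  "shift_rv T t \<omega> \<xi> \<omega>' = \<xi> (concat_path T t \<omega> \<omega>')"

definition shift_coeff ::
    "real \<Rightarrow> real \<Rightarrow> ('d::finite) path \<Rightarrow> (real \<Rightarrow> 'd path \<Rightarrow> 'a \<Rightarrow> 'x) \<Rightarrow>
     real \<Rightarrow> 'd path \<Rightarrow> 'a \<Rightarrow> 'x" where
  "shift_coeff T t \<omega> g s \<omega>' a = g (t + s) (concat_path T t \<omega> \<omega>') a"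

definition action_profiles :: "('n::finite \<Rightarrow> 'a::euclidean_space set) \<Rightarrow> ('a ^ 'n) set" where
  "action_profiles A = {a. \<forall>i. a $ i \<in> A i}"

definition player_controls ::
    "real \<Rightarrow> ('d::finite) path measure \<Rightarrow> 'a::euclidean_space set \<Rightarrow>
     (real \<Rightarrow> 'd path \<Rightarrow> 'a) set" where
  "player_controls T P S =
     {\<beta>. progressive T (aug_filt T P) borel \<beta> \<and>
         (\<forall>t\<in>{0..T}. \<forall>\<omega>\<in>path_space T. \<beta> t \<omega> \<in> S)}"

definition controls ::
    "real \<Rightarrow> ('d::finite) path measure \<Rightarrow> ('n::finite \<Rightarrow> 'a::euclidean_space set) \<Rightarrow>
     ('n \<Rightarrow> real \<Rightarrow> 'd path \<Rightarrow> 'a) set" where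
  "controls T P A = {\<alpha>. \<forall>i. \<alpha> i \<in> player_controls T P (A i)}"

definition profile_at ::
    "('n::finite \<Rightarrow> real \<Rightarrow> ('d::finite) path \<Rightarrow> 'a) \<Rightarrow> real \<Rightarrow> 'd path \<Rightarrow> 'a ^ 'n" where
  "profile_at \<alpha> s \<omega> = (\<chi> i. \<alpha> i s \<omega>)"

(* Data measurable for the augmented filtration can lose measurability when shifted at an
   exceptional (t, \<omega>), since {concat_path T t \<omega> \<omega>'} may be null; the conventions for
   non-existing integrals then apply. *)
definition controlled_measure ::
    "real \<Rightarrow> ('d::finite) path measure \<Rightarrow>
     (real \<Rightarrow> 'd path \<Rightarrow> 'a::euclidean_space ^ 'n::finite \<Rightarrow> real ^ 'd) \<Rightarrow>
     real \<Rightarrow> 'd path \<Rightarrow> ('n \<Rightarrow> real \<Rightarrow> 'd path \<Rightarrow> 'a) \<Rightarrow> 'd path measure" where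
  "controlled_measure T P b t \<omega> \<alpha> =
     (let H = (\<lambda>s \<omega>'. shift_coeff T t \<omega> b s \<omega>' (profile_at \<alpha> s \<omega>'))
      in density (completion P)
           (\<lambda>\<omega>'. ennreal (exp (ito_integral T P (T - t) H \<omega>'
              - 1 / 2 * (LINT s:{0..T - t}|lborel. (norm (H s \<omega>'))\<^sup>2)))))"

definition cost ::
    "real \<Rightarrow> ('d::finite) path measure \<Rightarrow>
     (real \<Rightarrow> 'd path \<Rightarrow> 'a::euclidean_space ^ 'n::finite \<Rightarrow> real ^ 'd) \<Rightarrow>
     (real \<Rightarrow> 'd path \<Rightarrow> 'a ^ 'n \<Rightarrow> real ^ 'n) \<Rightarrow> ('d path \<Rightarrow> real ^ 'n) \<Rightarrow>
     real \<Rightarrow> 'd path \<Rightarrow> ('n \<Rightarrow> real \<Rightarrow> 'd path \<Rightarrow> 'a) \<Rightarrow> real ^ 'n" where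
  "cost T P b f \<xi> t \<omega> \<alpha> =
     (\<chi> i. LINT \<omega>'|controlled_measure T P b t \<omega> \<alpha>.
        shift_rv T t \<omega> \<xi> \<omega>' $ i
        + (LINT s:{0..T - t}|lborel. shift_coeff T t \<omega> f s \<omega>' (profile_at \<alpha> s \<omega>') $ i))"

definition eps_equilibria ::
    "real \<Rightarrow> ('d::finite) path measure \<Rightarrow> ('n::finite \<Rightarrow> 'a::euclidean_space set) \<Rightarrow>
     (real \<Rightarrow> 'd path \<Rightarrow> 'a ^ 'n \<Rightarrow> real ^ 'd) \<Rightarrow>
     (real \<Rightarrow> 'd path \<Rightarrow> 'a ^ 'n \<Rightarrow> real ^ 'n) \<Rightarrow> ('d path \<Rightarrow> real ^ 'n) \<Rightarrow>
     real \<Rightarrow> real \<Rightarrow> 'd path \<Rightarrow> ('n \<Rightarrow> real \<Rightarrow> 'd path \<Rightarrow> 'a) set" where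
  "eps_equilibria T P A b f \<xi> \<epsilon> t \<omega> =
     {\<alpha> \<in> controls T P A. \<forall>i. \<forall>\<beta>\<in>player_controls T P (A i).
        cost T P b f \<xi> t \<omega> \<alpha> $ i \<le> cost T P b f \<xi> t \<omega> (\<alpha>(i := \<beta>)) $ i + \<epsilon>}"

definition value_set_eps ::
    "real \<Rightarrow> ('d::finite) path measure \<Rightarrow> ('n::finite \<Rightarrow> 'a::euclidean_space set) \<Rightarrow>
     (real \<Rightarrow> 'd path \<Rightarrow> 'a ^ 'n \<Rightarrow> real ^ 'd) \<Rightarrow>
     (real \<Rightarrow> 'd path \<Rightarrow> 'a ^ 'n \<Rightarrow> real ^ 'n) \<Rightarrow> ('d path \<Rightarrow> real ^ 'n) \<Rightarrow>
     real \<Rightarrow> real \<Rightarrow> 'd path \<Rightarrow> (real ^ 'n) set" where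
  "value_set_eps T P A b f \<xi> \<epsilon> t \<omega> =
     (\<Union>\<alpha>\<in>eps_equilibria T P A b f \<xi> \<epsilon> t \<omega>. ball (cost T P b f \<xi> t \<omega> \<alpha>) \<epsilon>)"

definition value_set ::
    "real \<Rightarrow> ('d::finite) path measure \<Rightarrow> ('n::finite \<Rightarrow> 'a::euclidean_space set) \<Rightarrow>
     (real \<Rightarrow> 'd path \<Rightarrow> 'a ^ 'n \<Rightarrow> real ^ 'd) \<Rightarrow>
     (real \<Rightarrow> 'd path \<Rightarrow> 'a ^ 'n \<Rightarrow> real ^ 'n) \<Rightarrow> ('d path \<Rightarrow> real ^ 'n) \<Rightarrow>
     real \<Rightarrow> 'd path \<Rightarrow> (real ^ 'n) set" where
  "value_set T P A b f \<xi> t \<omega> = (\<Inter>\<epsilon>\<in>{0<..}. value_set_eps T P A b f \<xi> \<epsilon> t \<omega>)"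

end

(* The only analytic point is a bound on the costs that is uniform over all controls; the topology of
   the value sets then follows since enlarging epsilon enlarges the set of equilibria and the radius of
   the balls alike.  As the data are bounded, it suffices to bound the total mass of the controlled
   measure, and its density is at most exp(I), where I is the stochastic integral of the drift (or 0, if
   no such integral exists).  For a simple process the exponential exp(I_n - E_n / 2), with E_n the
   energy, has expectation 1; if the drift is bounded by C on [0,u], then E_n is asymptotically at most
   2 C^2 u, so Fatou's lemma along an almost surely convergent subsequence gives E[exp(I)] <= exp(C^2 u). *)
theory Submission
  imports Defs
begin

section \<open>Completed Wiener space and its augmented filtration\<close>

lemma wiener_measure_prob_space_completion:
  assumes "wiener_measure T P"
  shows "prob_space (completion P)"
proof -
  interpret prob_space P using assms by (simp add: wiener_measure_def)
  show ?thesis by standard (simp add: emeasure_space_1)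
qed

lemma space_raw_filt [simp]: "space (raw_filt T t) = path_space T"
  by (simp add: raw_filt_def space_measure_of_conv)

lemma sets_raw_filt:
  "sets (raw_filt T t) = sigma_sets (path_space T)
     {(\<lambda>\<omega>. \<omega> s) -` S \<inter> path_space T | s S. s \<in> {0..t} \<and> S \<in> sets borel}"
  unfolding raw_filt_def by (intro sets_measure_of) auto

lemma space_wiener_measure: "wiener_measure T P \<Longrightarrow> space P = path_space T"
  using sets_eq_imp_space_eq[of P "raw_filt T T"] by (simp add: wiener_measure_def)

lemma space_aug_filt [simp]: "space (aug_filt T P t) = path_space T"
  by (simp add: aug_filt_def space_measure_of_conv)

lemma sets_aug_filt:
  assumes "wiener_measure T P"
  shows "sets (aug_filt T P t) =
    sigma_sets (path_space T) (sets (raw_filt T t) \<union> null_sets (completion P))"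
  unfolding aug_filt_def
proof (intro sets_measure_of Un_least)
  show "sets (raw_filt T t) \<subseteq> Pow (path_space T)"
    using sets.space_closed[of "raw_filt T t"] by simp
  show "null_sets (completion P) \<subseteq> Pow (path_space T)"
    using sets.space_closed[of "completion P"] space_wiener_measure[OF assms]
    by (auto dest: null_setsD2)
qed

lemma sets_raw_filt_mono: "s \<le> t \<Longrightarrow> sets (raw_filt T s) \<subseteq> sets (raw_filt T t)"
  unfolding sets_raw_filt by (intro sigma_sets_mono') fastforce

lemma sets_raw_filt_subset_aug_filt:
  "wiener_measure T P \<Longrightarrow> sets (raw_filt T t) \<subseteq> sets (aug_filt T P t)"
  by (auto simp: sets_aug_filt)

lemma sets_aug_filt_mono:
  "wiener_measure T P \<Longrightarrow> s \<le> t \<Longrightarrow> sets (aug_filt T P s) \<subseteq> sets (aug_filt T P t)"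
  using sets_raw_filt_mono[of s t T] by (auto simp: sets_aug_filt intro!: sigma_sets_mono')

lemma sets_aug_filt_subset_completion:
  assumes "wiener_measure T P" "t \<le> T"
  shows "sets (aug_filt T P t) \<subseteq> sets (completion P)"
proof -
  have "sets (raw_filt T t) \<subseteq> sets P"
    using sets_raw_filt_mono[OF assms(2)] assms(1) by (simp add: wiener_measure_def)
  then have "sets (raw_filt T t) \<union> null_sets (completion P) \<subseteq> sets (completion P)"
    by auto
  from sets.sigma_sets_subset[OF this] show ?thesis
    using assms by (simp add: sets_aug_filt space_wiener_measure)
qed

lemma measurable_aug_filt_mono:
  assumes "wiener_measure T P" "s \<le> t" "g \<in> aug_filt T P s \<rightarrow>\<^sub>M N"
  shows "g \<in> aug_filt T P t \<rightarrow>\<^sub>M N"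
  using assms(3) sets_aug_filt_mono[OF assms(1,2)] by (auto simp: measurable_def)

lemma measurable_aug_filt_completion:
  assumes "wiener_measure T P" "t \<le> T" "g \<in> aug_filt T P t \<rightarrow>\<^sub>M N"
  shows "g \<in> completion P \<rightarrow>\<^sub>M N"
  using assms(3) sets_aug_filt_subset_completion[OF assms(1,2)] space_wiener_measure[OF assms(1)]
  by (auto simp: measurable_def)

lemma path_eval_measurable_raw_filt:
  assumes "s \<in> {0..t}"
  shows "(\<lambda>\<omega>. \<omega> s) \<in> borel_measurable (raw_filt T t)"
  using assms by (auto simp: measurable_def sets_raw_filt intro!: sigma_sets.Basic)

lemma path_eval_measurable_aug_filt:
  assumes "wiener_measure T P" "s \<in> {0..t}"
  shows "(\<lambda>\<omega>. \<omega> s) \<in> borel_measurable (aug_filt T P t)"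
  using path_eval_measurable_raw_filt[OF assms(2), of T]
    sets_raw_filt_subset_aug_filt[OF assms(1)] by (auto simp: measurable_def)

text \<open>The sets that agree almost surely with some raw set form a sigma-algebra, and it
  contains the null sets, which agree with the empty set. Augmentation therefore changes events only
  by null sets, so independence can be carried over from the raw filtration.\<close>

lemma aug_filt_AE_eq_raw_filt:
  assumes W: "wiener_measure T P" and t: "t \<le> T" and E: "E \<in> sets (aug_filt T P t)"
  shows "\<exists>B\<in>sets (raw_filt T t). AE \<omega> in completion P. \<omega> \<in> E \<longleftrightarrow> \<omega> \<in> B"
  using E unfolding sets_aug_filt[OF W]
proof induction
  case (Basic E)
  then show ?case
  proof
    assume "E \<in> null_sets (completion P)"
    then show ?thesis by (intro bexI[of _ "{}"]) (auto dest: AE_not_in)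
  qed auto
next
  case Empty
  then show ?case by (intro bexI[of _ "{}"]) auto
next
  case (Compl E)
  then obtain B where "B \<in> sets (raw_filt T t)" "AE \<omega> in completion P. \<omega> \<in> E \<longleftrightarrow> \<omega> \<in> B" by auto
  then show ?case
    using sets.compl_sets[of B "raw_filt T t"]
    by (intro bexI[of _ "path_space T - B"]) auto
next
  case (Union E)
  then obtain B where B: "\<And>i. B i \<in> sets (raw_filt T t)"
    "\<And>i::nat. AE \<omega> in completion P. \<omega> \<in> E i \<longleftrightarrow> \<omega> \<in> B i" by metis
  have "AE \<omega> in completion P. \<forall>i. \<omega> \<in> E i \<longleftrightarrow> \<omega> \<in> B i"
    using B(2) by (simp add: AE_all_countable)
  then show ?case using B(1) by (intro bexI[of _ "\<Union>i. B i"]) auto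
qed

text \<open>Replacing an augmented event by an almost surely equal raw one changes no probability,
  so the product formula in \<open>wiener_measure\<close> passes to the completion.\<close>

lemma indep_set_aug_filt_increment:
  fixes P :: "('d::finite) path measure"
  assumes W: "wiener_measure T P" and st: "0 \<le> s" "s < t" "t \<le> T"
  shows "prob_space.indep_set (completion P) (sets (aug_filt T P s))
    {(\<lambda>\<omega> :: 'd path. \<omega> t - \<omega> s) -` S \<inter> path_space T | S. S \<in> sets borel}"
proof -
  interpret P: prob_space P using W by (simp add: wiener_measure_def)
  interpret cP: prob_space "completion P" by (rule wiener_measure_prob_space_completion[OF W])
  let ?Y = "{(\<lambda>\<omega> :: 'd path. \<omega> t - \<omega> s) -` S \<inter> path_space T | S. S \<in> sets borel}"
  have ind: "P.indep_set (sets (raw_filt T s)) ?Y"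
    using W st by (auto simp: wiener_measure_def)
  have sub: "sets (raw_filt T s) \<subseteq> sets P" "?Y \<subseteq> sets P"
    using P.indep_setD_ev1[OF ind] P.indep_setD_ev2[OF ind] by auto
  show ?thesis
  proof (rule cP.indep_setI)
    show "sets (aug_filt T P s) \<subseteq> cP.events"
      using st by (intro sets_aug_filt_subset_completion[OF W]) auto
    show "?Y \<subseteq> cP.events" using sub by auto
    fix E F assume E: "E \<in> sets (aug_filt T P s)" and F: "F \<in> ?Y"
    have Ec: "E \<in> sets (completion P)"
      using sets_aug_filt_subset_completion[OF W, of s] E st by auto
    obtain B where B: "B \<in> sets (raw_filt T s)"
      and ae: "AE \<omega> in completion P. \<omega> \<in> E \<longleftrightarrow> \<omega> \<in> B"
      using aug_filt_AE_eq_raw_filt[OF W _ E] st by auto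
    have BP: "B \<in> sets P" "F \<in> sets P" using B F sub by blast+
    have "cP.prob (E \<inter> F) = cP.prob (B \<inter> F)"
      using ae BP Ec by (intro measure_eq_AE) auto
    also have "\<dots> = P.prob B * P.prob F"
      using BP P.indep_setD[OF ind B F] by (simp add: measure_completion)
    also have "P.prob B = cP.prob E"
      using ae BP Ec measure_eq_AE[of E B "completion P"] by (simp add: measure_completion)
    finally show "cP.prob (E \<inter> F) = cP.prob E * cP.prob F"
      using BP by (simp add: measure_completion)
  qed
qed

section \<open>Independence, Gaussian increments and one step of the exponential martingale\<close>

lemma (in prob_space) nn_integral_indep_set:
  assumes X: "random_variable S X" and Y: "random_variable N Y"
    and ind: "indep_set {X -` A \<inter> space M | A. A \<in> sets S} {Y -` A \<inter> space M | A. A \<in> sets N}"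
    and F: "F \<in> borel_measurable (S \<Otimes>\<^sub>M N)"
  shows "(\<integral>\<^sup>+\<omega>. F (X \<omega>, Y \<omega>) \<partial>M) = (\<integral>\<^sup>+\<omega>. \<integral>\<^sup>+y. F (X \<omega>, y) \<partial>distr M N Y \<partial>M)"
proof -
  interpret X: prob_space "distr M S X" by (rule prob_space_distr[OF X])
  interpret Y: prob_space "distr M N Y" by (rule prob_space_distr[OF Y])
  have XY: "(\<lambda>\<omega>. (X \<omega>, Y \<omega>)) \<in> M \<rightarrow>\<^sub>M S \<Otimes>\<^sub>M N" using X Y by measurable
  \<comment> \<open>Independence says exactly that the joint law is the product law on rectangles.
    Tonelli's theorem then allows \<open>X\<close> to be frozen while \<open>Y\<close> is integrated
    out, which plays the role of conditioning on \<open>X\<close>.\<close>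
  have eq: "distr M S X \<Otimes>\<^sub>M distr M N Y = distr M (S \<Otimes>\<^sub>M N) (\<lambda>\<omega>. (X \<omega>, Y \<omega>))"
  proof (rule pair_measure_eqI)
    fix A B assume "A \<in> sets (distr M S X)" "B \<in> sets (distr M N Y)"
    then have A: "A \<in> sets S" and B: "B \<in> sets N" by auto
    let ?A = "X -` A \<inter> space M" and ?B = "Y -` B \<inter> space M"
    have "prob (?A \<inter> ?B) = prob ?A * prob ?B"
      using A B by (intro indep_setD[OF ind]) auto
    moreover have "(\<lambda>\<omega>. (X \<omega>, Y \<omega>)) -` (A \<times> B) \<inter> space M = ?A \<inter> ?B" by auto
    ultimately show "emeasure (distr M S X) A * emeasure (distr M N Y) B
        = emeasure (distr M (S \<Otimes>\<^sub>M N) (\<lambda>\<omega>. (X \<omega>, Y \<omega>))) (A \<times> B)"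
      using A B by (simp add: emeasure_distr X Y XY emeasure_eq_measure ennreal_mult)
  qed (auto intro: X.sigma_finite_measure Y.sigma_finite_measure cong: sets_pair_measure_cong)
  have m: "F \<in> borel_measurable (S \<Otimes>\<^sub>M distr M N Y)"
    using F by (simp cong: measurable_cong_sets sets_pair_measure_cong)
  have "(\<integral>\<^sup>+\<omega>. F (X \<omega>, Y \<omega>) \<partial>M) = integral\<^sup>N (distr M S X \<Otimes>\<^sub>M distr M N Y) F"
    unfolding eq using XY F by (subst nn_integral_distr) auto
  also have "\<dots> = (\<integral>\<^sup>+x. \<integral>\<^sup>+y. F (x, y) \<partial>distr M N Y \<partial>distr M S X)"
    using F by (intro Y.nn_integral_fst[symmetric]) (simp cong: measurable_cong_sets sets_pair_measure_cong)
  also have "\<dots> = (\<integral>\<^sup>+\<omega>. \<integral>\<^sup>+y. F (X \<omega>, y) \<partial>distr M N Y \<partial>M)"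
    using Y.borel_measurable_nn_integral_fst[OF m] X by (subst nn_integral_distr) auto
  finally show ?thesis .
qed

lemma nn_integral_lborel_translate:
  fixes g :: "'a::euclidean_space \<Rightarrow> ennreal"
  assumes "g \<in> borel_measurable borel"
  shows "(\<integral>\<^sup>+x. g (c + x) \<partial>lborel) = (\<integral>\<^sup>+x. g x \<partial>lborel)"
  using assms
  by (subst (2) lborel_distr_plus[of c, symmetric], subst nn_integral_distr) auto

text \<open>Completing the square turns the exponential tilt into a translation of the density, so
  translation invariance of Lebesgue measure replaces the computation of a Gaussian integral.\<close>
lemma wiener_increment_exponential:
  fixes P :: "('d::finite) path measure" and c :: "real ^ 'd"
  assumes W: "wiener_measure T P" and st: "0 \<le> s" "s < t" "t \<le> T"
  shows "(\<integral>\<^sup>+y. ennreal (exp (c \<bullet> y - (t - s) / 2 * (norm c)\<^sup>2))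
      \<partial>distr (completion P) borel (\<lambda>\<omega>. \<omega> t - \<omega> s)) = 1"
proof -
  interpret P: prob_space P using W by (simp add: wiener_measure_def)
  interpret cP: prob_space "completion P" by (rule wiener_measure_prob_space_completion[OF W])
  define \<sigma> where "\<sigma> = sqrt (t - s)"
  have \<sigma>: "\<sigma> > 0" "\<sigma>\<^sup>2 = t - s" using st by (auto simp: \<sigma>_def)
  define g where "g x = ennreal (\<Prod>j\<in>UNIV. normal_density 0 \<sigma> (x $ j))" for x :: "real ^ 'd"
  have gm [measurable]: "g \<in> borel_measurable borel" unfolding g_def by measurable
  have D: "distributed P lborel (\<lambda>\<omega>. \<omega> t - \<omega> s) g"
    using W st by (auto simp: wiener_measure_def g_def[abs_def] \<sigma>_def)
  have Ym: "(\<lambda>\<omega>. \<omega> t - \<omega> s) \<in> borel_measurable P"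
    using distributed_measurable[OF D] by simp
  then have Ymc: "(\<lambda>\<omega>. \<omega> t - \<omega> s) \<in> borel_measurable (completion P)"
    by (rule measurable_completion)
  have int: "(\<integral>\<^sup>+x. g x * h x \<partial>lborel) = (\<integral>\<^sup>+\<omega>. h (\<omega> t - \<omega> s) \<partial>P)"
    if "h \<in> borel_measurable borel" for h
    using distributed_nn_integral[OF D, of h] that by simp
  have tilt: "g x * ennreal (exp (c \<bullet> x - (t - s) / 2 * (norm c)\<^sup>2)) = g (- (\<sigma>\<^sup>2 *\<^sub>R c) + x)" for x
  proof -
    have 1: "c \<bullet> x - (t - s) / 2 * (norm c)\<^sup>2 = (\<Sum>j\<in>UNIV. c $ j * x $ j - \<sigma>\<^sup>2 / 2 * (c $ j)\<^sup>2)"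
      unfolding power2_norm_eq_inner
      by (simp add: inner_vec_def \<sigma>(2) sum_subtractf sum_distrib_left power2_eq_square[of "c $ _"])
    have 2: "normal_density 0 \<sigma> (x $ j) * exp (c $ j * x $ j - \<sigma>\<^sup>2 / 2 * (c $ j)\<^sup>2)
        = normal_density 0 \<sigma> ((- (\<sigma>\<^sup>2 *\<^sub>R c) + x) $ j)" for j
    proof -
      have "- (x $ j)\<^sup>2 / (2 * \<sigma>\<^sup>2) + (c $ j * x $ j - \<sigma>\<^sup>2 / 2 * (c $ j)\<^sup>2)
          = - (- (\<sigma>\<^sup>2 * c $ j) + x $ j)\<^sup>2 / (2 * \<sigma>\<^sup>2)"
        using \<sigma>(1) by (simp add: field_simps power2_eq_square)
      then show ?thesis
        by (simp add: normal_density_def exp_add[symmetric] mult.assoc)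
    qed
    show ?thesis
      unfolding g_def 1 exp_sum[OF finite] 2[symmetric] prod.distrib
      by (subst ennreal_mult') (auto intro!: prod_nonneg)
  qed
  have "(\<integral>\<^sup>+y. ennreal (exp (c \<bullet> y - (t - s) / 2 * (norm c)\<^sup>2))
        \<partial>distr (completion P) borel (\<lambda>\<omega>. \<omega> t - \<omega> s))
      = (\<integral>\<^sup>+\<omega>. ennreal (exp (c \<bullet> (\<omega> t - \<omega> s) - (t - s) / 2 * (norm c)\<^sup>2)) \<partial>P)"
    by (subst nn_integral_distr[OF Ymc]) (auto simp: nn_integral_completion)
  also have "\<dots> = (\<integral>\<^sup>+x. g (- (\<sigma>\<^sup>2 *\<^sub>R c) + x) \<partial>lborel)"
    by (subst int[symmetric]) (simp_all only: tilt, measurable)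
  \<comment> \<open>The factor 1 makes \<open>int\<close> applicable once more: the mass of the
    translated density is the total mass of \<open>P\<close>.\<close>
  also have "\<dots> = (\<integral>\<^sup>+x. g x * 1 \<partial>lborel)"
    by (simp only: nn_integral_lborel_translate[OF gm] mult_1_right)
  also have "\<dots> = 1" by (subst int) (auto simp: P.emeasure_space_1)
  finally show ?thesis .
qed

text \<open>The pair \<open>(Z, \<eta>)\<close> is known at time \<open>s\<close> and hence
  independent of the increment. Once it is frozen, the exponential factor integrates to 1 by
  \<open>wiener_increment_exponential\<close>, which leaves the integral of
  \<open>Z\<close>.\<close>

lemma exponential_martingale_step:
  fixes P :: "('d::finite) path measure" and \<eta> :: "'d path \<Rightarrow> real ^ 'd" and Z :: "'d path \<Rightarrow> ennreal"
  assumes W: "wiener_measure T P" and st: "0 \<le> s" "s \<le> t" "t \<le> T"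
    and Z: "Z \<in> borel_measurable (aug_filt T P s)"
    and \<eta>: "\<eta> \<in> borel_measurable (aug_filt T P s)"
  shows "(\<integral>\<^sup>+\<omega>. Z \<omega> * ennreal (exp (\<eta> \<omega> \<bullet> (\<omega> t - \<omega> s) - (t - s) / 2 * (norm (\<eta> \<omega>))\<^sup>2))
      \<partial>completion P) = (\<integral>\<^sup>+\<omega>. Z \<omega> \<partial>completion P)"
proof (cases "s = t")
  \<comment> \<open>\<open>wiener_measure\<close> describes increments over intervals of positive
    length only; a degenerate step has exponent 0.\<close>
  case False
  then have st': "s < t" using st by simp
  interpret cP: prob_space "completion P" by (rule wiener_measure_prob_space_completion[OF W])
  let ?X = "\<lambda>\<omega>. (Z \<omega>, \<eta> \<omega>)" and ?Y = "\<lambda>\<omega>::'d path. \<omega> t - \<omega> s"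
  have X: "?X \<in> aug_filt T P s \<rightarrow>\<^sub>M borel \<Otimes>\<^sub>M borel" using Z \<eta> by measurable
  have Ym: "?Y \<in> borel_measurable (aug_filt T P T)"
    using st by (intro borel_measurable_diff path_eval_measurable_aug_filt[OF W]) auto
  have sp: "space (completion P) = path_space T" using space_wiener_measure[OF W] by simp
  have ind: "cP.indep_set {?X -` A \<inter> space (completion P) | A. A \<in> sets (borel \<Otimes>\<^sub>M borel)}
      {?Y -` A \<inter> space (completion P) | A. A \<in> sets borel}"
  proof (rule cP.indep_setI)
    note I = indep_set_aug_filt_increment[OF W st(1) st' st(3)]
    have sub: "{?X -` A \<inter> space (completion P) | A. A \<in> sets (borel \<Otimes>\<^sub>M borel)}
        \<subseteq> sets (aug_filt T P s)"
      using measurable_sets[OF X] by (auto simp: space_wiener_measure[OF W])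
    show "{?X -` A \<inter> space (completion P) | A. A \<in> sets (borel \<Otimes>\<^sub>M borel)} \<subseteq> cP.events"
      using sub cP.indep_setD_ev1[OF I] by (rule order_trans)
    show "{?Y -` A \<inter> space (completion P) | A. A \<in> sets borel} \<subseteq> cP.events"
      using cP.indep_setD_ev2[OF I] by (simp only: sp)
    fix E F assume "E \<in> {?X -` A \<inter> space (completion P) | A. A \<in> sets (borel \<Otimes>\<^sub>M borel)}"
      and F: "F \<in> {?Y -` A \<inter> space (completion P) | A. A \<in> sets borel}"
    then have "E \<in> sets (aug_filt T P s)" using sub by blast
    from cP.indep_setD[OF I this F[unfolded sp]]
    show "cP.prob (E \<inter> F) = cP.prob E * cP.prob F" .
  qed
  let ?F = "\<lambda>p. fst (fst p) *
      ennreal (exp (snd (fst p) \<bullet> snd p - (t - s) / 2 * (norm (snd (fst p)))\<^sup>2))"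
  have F: "?F \<in> borel_measurable
      (((borel :: ennreal measure) \<Otimes>\<^sub>M (borel :: (real ^ 'd) measure)) \<Otimes>\<^sub>M (borel :: (real ^ 'd) measure))"
    by measurable
  have Yc: "?Y \<in> borel_measurable (completion P)"
    by (intro measurable_aug_filt_completion[OF W _ Ym]) auto
  have Xc: "?X \<in> completion P \<rightarrow>\<^sub>M borel \<Otimes>\<^sub>M borel"
    using st by (intro measurable_aug_filt_completion[OF W _ X]) auto
  show ?thesis
    using cP.nn_integral_indep_set[OF Xc Yc ind F]
    by (simp add: nn_integral_cmult wiener_increment_exponential[OF W st(1) st' st(3), simplified])
qed simp

section \<open>Simple processes, their integrals and their energy\<close>

lemma simple_data_mono:
  assumes "simple_data T P u m \<tau> \<eta>" "j \<le> k" "k \<le> m"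
  shows "\<tau> j \<le> \<tau> k"
  using assms(2,3)
proof (induction k rule: dec_induct)
  case (step n)
  then have "\<tau> j \<le> \<tau> n" "\<tau> n \<le> \<tau> (Suc n)" using assms(1) by (auto simp: simple_data_def)
  then show ?case by simp
qed simp

lemma simple_data_times:
  assumes "simple_data T P u m \<tau> \<eta>" "k \<le> m"
  shows "\<tau> k \<in> {0..u}"
  using simple_data_mono[OF assms(1), of 0 k] simple_data_mono[OF assms(1), of k m] assms
  by (auto simp: simple_data_def)

text \<open>Stated for every partial sum and not only for \<open>m\<close>: in the induction over
  the partition, the first \<open>n\<close> terms are the past of the next step and have to be known
  at time \<open>\<tau> n\<close>.\<close>

lemma simple_integral_measurable:
  fixes P :: "('d::finite) path measure"
  assumes W: "wiener_measure T P" and D: "simple_data T P u m \<tau> \<eta>" and n: "n \<le> m"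
  shows "simple_integral n \<tau> \<eta> \<in> borel_measurable (aug_filt T P (\<tau> n))"
proof -
  have "(\<lambda>\<omega>. \<eta> k \<omega> \<bullet> (\<omega> (\<tau> (Suc k)) - \<omega> (\<tau> k))) \<in> borel_measurable (aug_filt T P (\<tau> n))"
    if k: "k < n" for k
  proof (rule borel_measurable_inner)
    show "\<eta> k \<in> borel_measurable (aug_filt T P (\<tau> n))"
      using k n D simple_data_mono[OF D, of k n]
      by (auto simp: simple_data_def intro: measurable_aug_filt_mono[OF W, where s="\<tau> k"])
    show "(\<lambda>\<omega>. \<omega> (\<tau> (Suc k)) - \<omega> (\<tau> k)) \<in> borel_measurable (aug_filt T P (\<tau> n))"
      using k n simple_data_mono[OF D, of "Suc k" n] simple_data_mono[OF D, of k n]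
        simple_data_times[OF D, of "Suc k"] simple_data_times[OF D, of k]
      by (intro borel_measurable_diff path_eval_measurable_aug_filt[OF W]) auto
  qed
  then show ?thesis
    unfolding simple_integral_def[abs_def] by (intro borel_measurable_sum) simp
qed

text \<open>For simple data this is the quadratic variation of the simple integral. The closed form
  as a sum over the partition makes it visibly additive in the steps and adapted; its identity with
  a time integral comes in \<open>nn_integral_simple_process_square\<close>.\<close>

definition simple_energy ::
    "nat \<Rightarrow> (nat \<Rightarrow> real) \<Rightarrow> (nat \<Rightarrow> ('d::finite) path \<Rightarrow> real ^ 'd) \<Rightarrow> 'd path \<Rightarrow> real" where
  "simple_energy m \<tau> \<eta> \<omega> = (\<Sum>k<m. (\<tau> (Suc k) - \<tau> k) * (norm (\<eta> k \<omega>))\<^sup>2)"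

lemma simple_energy_measurable:
  fixes P :: "('d::finite) path measure"
  assumes W: "wiener_measure T P" and D: "simple_data T P u m \<tau> \<eta>" and n: "n \<le> m"
  shows "simple_energy n \<tau> \<eta> \<in> borel_measurable (aug_filt T P (\<tau> n))"
proof -
  have "\<eta> k \<in> borel_measurable (aug_filt T P (\<tau> n))" if "k < n" for k
    using that n D simple_data_mono[OF D, of k n]
    by (auto simp: simple_data_def intro: measurable_aug_filt_mono[OF W, where s="\<tau> k"])
  then show ?thesis unfolding simple_energy_def[abs_def] by measurable
qed

text \<open>Each interval of the partition multiplies the exponential by one factor of the kind in
  \<open>exponential_martingale_step\<close>, so the expectation stays at its initial value 1 along
  the partition.\<close>

lemma nn_integral_simple_exponential:
  fixes P :: "('d::finite) path measure"
  assumes W: "wiener_measure T P" and D: "simple_data T P u m \<tau> \<eta>" and u: "u \<le> T"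
  shows "(\<integral>\<^sup>+\<omega>. ennreal (exp (simple_integral m \<tau> \<eta> \<omega> - simple_energy m \<tau> \<eta> \<omega> / 2))
    \<partial>completion P) = 1"
proof -
  interpret cP: prob_space "completion P" by (rule wiener_measure_prob_space_completion[OF W])
  have "(\<integral>\<^sup>+\<omega>. ennreal (exp (simple_integral n \<tau> \<eta> \<omega> - simple_energy n \<tau> \<eta> \<omega> / 2))
    \<partial>completion P) = 1" if "n \<le> m" for n
    using that
  proof (induction n)
    case 0
    then show ?case
      using cP.emeasure_space_1 by (simp add: simple_integral_def simple_energy_def)
  next
    case (Suc n)
    let ?Z = "\<lambda>\<omega>. ennreal (exp (simple_integral n \<tau> \<eta> \<omega> - simple_energy n \<tau> \<eta> \<omega> / 2))"
    let ?E = "\<lambda>\<omega>. ennreal (exp (\<eta> n \<omega> \<bullet> (\<omega> (\<tau> (Suc n)) - \<omega> (\<tau> n))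
        - (\<tau> (Suc n) - \<tau> n) / 2 * (norm (\<eta> n \<omega>))\<^sup>2))"
    have [measurable]: "simple_integral n \<tau> \<eta> \<in> borel_measurable (aug_filt T P (\<tau> n))"
      "simple_energy n \<tau> \<eta> \<in> borel_measurable (aug_filt T P (\<tau> n))"
      using simple_integral_measurable[OF W D] simple_energy_measurable[OF W D] Suc.prems by auto
    have "(\<integral>\<^sup>+\<omega>. ennreal (exp (simple_integral (Suc n) \<tau> \<eta> \<omega>
        - simple_energy (Suc n) \<tau> \<eta> \<omega> / 2)) \<partial>completion P) = (\<integral>\<^sup>+\<omega>. ?Z \<omega> * ?E \<omega> \<partial>completion P)"
      by (intro nn_integral_cong)
        (simp add: simple_integral_def simple_energy_def ennreal_mult[symmetric]
          exp_add[symmetric] diff_divide_distrib add_divide_distrib)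
    also have "\<dots> = (\<integral>\<^sup>+\<omega>. ?Z \<omega> \<partial>completion P)"
    proof (rule exponential_martingale_step[OF W])
      show "0 \<le> \<tau> n" "\<tau> n \<le> \<tau> (Suc n)" "\<tau> (Suc n) \<le> T"
        using Suc.prems simple_data_times[OF D, of n] simple_data_times[OF D, of "Suc n"]
          simple_data_mono[OF D, of n "Suc n"] u by auto
      show "\<eta> n \<in> borel_measurable (aug_filt T P (\<tau> n))"
        using D Suc.prems by (simp add: simple_data_def)
    qed measurable
    also have "\<dots> = 1" using Suc by simp
    finally show ?case .
  qed
  then show ?thesis by simp
qed

text \<open>The half-open intervals of the partition are disjoint, so at any time at most one
  summand is nonzero and the square has no cross terms.\<close>

lemma norm_simple_process_square:
  assumes D: "simple_data T P u m \<tau> \<eta>"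
  shows "(norm (simple_process m \<tau> \<eta> s \<omega>))\<^sup>2
    = (\<Sum>k<m. indicator {\<tau> k<..\<tau> (Suc k)} s * (norm (\<eta> k \<omega>))\<^sup>2)"
proof -
  have "(norm (simple_process n \<tau> \<eta> s \<omega>))\<^sup>2
    = (\<Sum>k<n. indicator {\<tau> k<..\<tau> (Suc k)} s * (norm (\<eta> k \<omega>))\<^sup>2)" if "n \<le> m" for n
    using that
  proof (induction n)
    case (Suc n)
    show ?case
    proof (cases "s \<in> {\<tau> n<..\<tau> (Suc n)}")
      case True
      have "s \<notin> {\<tau> k<..\<tau> (Suc k)}" if "k < n" for k
        using True simple_data_mono[OF D, of "Suc k" n] Suc.prems that by auto
      then show ?thesis using True by (simp add: simple_process_def)
    next
      case False
      then show ?thesis using Suc by (simp add: simple_process_def)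
    qed
  qed (simp add: simple_process_def)
  then show ?thesis by simp
qed

text \<open>This links the energy, which appears in the exponential, to the squared time norm in
  which \<open>is_ito_integral\<close> measures the approximation of \<open>H\<close>.\<close>

lemma nn_integral_simple_process_square:
  assumes D: "simple_data T P u m \<tau> \<eta>"
  shows "(\<integral>\<^sup>+s\<in>{0..u}. ennreal ((norm (simple_process m \<tau> \<eta> s \<omega>))\<^sup>2) \<partial>lborel)
    = ennreal (simple_energy m \<tau> \<eta> \<omega>)"
proof -
  have "(\<integral>\<^sup>+s\<in>{0..u}. ennreal ((norm (simple_process m \<tau> \<eta> s \<omega>))\<^sup>2) \<partial>lborel)
    = (\<integral>\<^sup>+s. (\<Sum>k<m. ennreal ((norm (\<eta> k \<omega>))\<^sup>2) * indicator {\<tau> k<..\<tau> (Suc k)} s) \<partial>lborel)"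
  proof (intro nn_integral_cong)
    fix s
    have "(\<Sum>k<m. ennreal ((norm (\<eta> k \<omega>))\<^sup>2) * indicator {\<tau> k<..\<tau> (Suc k)} s)
      = ennreal ((norm (simple_process m \<tau> \<eta> s \<omega>))\<^sup>2)"
      unfolding norm_simple_process_square[OF D]
      by (subst sum_ennreal[symmetric]) (auto simp: indicator_def intro!: sum.cong)
    \<comment> \<open>All intervals lie in \<open>{0..u}\<close>, so the simple process vanishes
      elsewhere and restricting the integral loses nothing.\<close>
    moreover have "(norm (simple_process m \<tau> \<eta> s \<omega>))\<^sup>2 = 0" if "s \<notin> {0..u}"
      unfolding norm_simple_process_square[OF D]
    proof (intro sum.neutral ballI)
      fix k assume "k \<in> {..<m}"
      then show "indicator {\<tau> k<..\<tau> (Suc k)} s * (norm (\<eta> k \<omega>))\<^sup>2 = 0"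
        using simple_data_times[OF D, of k] simple_data_times[OF D, of "Suc k"] that by auto
    qed
    ultimately show "ennreal ((norm (simple_process m \<tau> \<eta> s \<omega>))\<^sup>2) * indicator {0..u} s
      = (\<Sum>k<m. ennreal ((norm (\<eta> k \<omega>))\<^sup>2) * indicator {\<tau> k<..\<tau> (Suc k)} s)"
      by (cases "s \<in> {0..u}") auto
  qed
  also have "\<dots> = (\<Sum>k<m. ennreal ((norm (\<eta> k \<omega>))\<^sup>2) * ennreal (\<tau> (Suc k) - \<tau> k))"
    using D by (subst nn_integral_sum) (auto simp: nn_integral_cmult simple_data_def intro!: sum.cong)
  also have "\<dots> = ennreal (simple_energy m \<tau> \<eta> \<omega>)"
    unfolding simple_energy_def using D
    by (subst sum_ennreal[symmetric])
      (auto simp: simple_data_def ennreal_mult[symmetric] mult.commute intro!: sum.cong)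
  finally show ?thesis .
qed

section \<open>Passage to the limit in the stochastic exponential\<close>

lemma nn_integral_tendsto_0_AE_subseq:
  fixes W :: "nat \<Rightarrow> 'a \<Rightarrow> ennreal"
  assumes W [measurable]: "\<And>n. W n \<in> borel_measurable M"
    and lim: "(\<lambda>n. \<integral>\<^sup>+x. W n x \<partial>M) \<longlonglongrightarrow> 0"
  shows "\<exists>r. AE x in M. (\<lambda>n. W (r n) x) \<longlonglongrightarrow> 0"
proof -
  have "\<exists>k. (\<integral>\<^sup>+x. W k x \<partial>M) < ennreal ((1 / 2) ^ n)" for n
  proof -
    have "eventually (\<lambda>k. (\<integral>\<^sup>+x. W k x \<partial>M) < ennreal ((1 / 2) ^ n)) sequentially"
      by (rule order_tendstoD(2)[OF lim]) simp
    then show ?thesis by (auto simp: eventually_sequentially)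
  qed
  then obtain r where r: "\<And>n. (\<integral>\<^sup>+x. W (r n) x \<partial>M) < ennreal ((1 / 2) ^ n)" by metis
  \<comment> \<open>The indices \<open>r\<close> make the integrals summable, so the sum of the
    functions has a finite integral and is finite almost everywhere; the terms of such a series tend
    to 0. Nothing makes \<open>r\<close> increasing, and Fatou's lemma can be applied along any
    sequence of indices.\<close>
  have "(\<integral>\<^sup>+x. (\<Sum>n. W (r n) x) \<partial>M) = (\<Sum>n. \<integral>\<^sup>+x. W (r n) x \<partial>M)"
    by (rule nn_integral_suminf) simp
  also have "\<dots> \<le> (\<Sum>n. ennreal ((1 / 2) ^ n))"
    using r by (intro suminf_le) (auto intro: less_imp_le)
  also have "\<dots> = ennreal (\<Sum>n. (1 / 2) ^ n)"
    by (rule suminf_ennreal2) (auto intro: summable_geometric)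
  also have "\<dots> < \<infinity>" by simp
  finally have "AE x in M. (\<Sum>n. W (r n) x) \<noteq> \<infinity>"
    by (intro nn_integral_PInf_AE) auto
  then have "AE x in M. (\<lambda>n. W (r n) x) \<longlonglongrightarrow> 0"
  proof eventually_elim
    case (elim x)
    have "W (r n) x \<noteq> \<infinity>" for n
      using elim ennreal_suminf_lessD[of "\<lambda>n. W (r n) x" \<infinity> n] by (auto simp: less_top)
    then have eq: "W (r n) x = ennreal (enn2real (W (r n) x))" for n
      by (simp add: less_top)
    have "summable (\<lambda>n. enn2real (W (r n) x))"
      using elim by (intro summable_suminf_not_top) (simp_all add: eq[symmetric])
    from summable_LIMSEQ_zero[OF this] show ?case
      by (subst eq) (auto intro: tendsto_ennrealI[where x=0, simplified])
  qed
  then show ?thesis by (rule exI[of _ r])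
qed

text \<open>Only the approximations granted by \<open>is_ito_integral\<close> enter, so the bound
  holds for every version \<open>I\<close> and sees \<open>H\<close> through \<open>C\<close> alone.
  This is what makes it uniform over the controls.\<close>

lemma ito_integral_exponential_bound:
  fixes P :: "('d::finite) path measure"
  assumes W: "wiener_measure T P" and u: "0 \<le> u" "u \<le> T"
    and I: "is_ito_integral T P u H I"
    and C: "\<And>s \<omega>. s \<in> {0..u} \<Longrightarrow> \<omega> \<in> path_space T \<Longrightarrow> norm (H s \<omega>) \<le> C"
  shows "(\<integral>\<^sup>+\<omega>. ennreal (exp (I \<omega>)) \<partial>completion P) \<le> ennreal (exp (C\<^sup>2 * u))"
proof -
  obtain m \<tau> \<eta> where D: "\<And>n. simple_data T P u (m n) (\<tau> n) (\<eta> n)"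
    and limH: "(\<lambda>n. \<integral>\<^sup>+\<omega>. (\<integral>\<^sup>+s\<in>{0..u}.
        ennreal ((norm (H s \<omega> - simple_process (m n) (\<tau> n) (\<eta> n) s \<omega>))\<^sup>2) \<partial>lborel)
        \<partial>completion P) \<longlonglongrightarrow> 0"
    and limI: "(\<lambda>n. \<integral>\<^sup>+\<omega>. ennreal ((I \<omega> - simple_integral (m n) (\<tau> n) (\<eta> n) \<omega>)\<^sup>2)
        \<partial>completion P) \<longlonglongrightarrow> 0"
    using I unfolding is_ito_integral_def by blast
  \<comment> \<open>The time integrals are rewritten over the restricted measure because progressive
    measurability of \<open>H\<close> is joint measurability over exactly this time space.\<close>
  define N where "N = restrict_space lborel {0..u}"
  interpret N: sigma_finite_measure N
    unfolding N_def by (intro sigma_finite_measure_restrict_space lborel.sigma_finite_measure_axioms) auto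
  have N: "(\<integral>\<^sup>+s\<in>{0..u}. g s \<partial>lborel) = (\<integral>\<^sup>+s. g s \<partial>N)" for g
    unfolding N_def by (simp add: nn_integral_restrict_space)
  have setsN: "sets N = sets (restrict_space borel {0..u})"
    unfolding N_def by (intro sets_restrict_space_cong) simp
  have spN: "space N = {0..u}" by (simp add: N_def space_restrict_space)
  have sp: "space (completion P) = path_space T" using space_wiener_measure[OF W] by simp
  have emN: "emeasure N (space N) = ennreal u"
    using u by (simp add: N_def space_restrict_space emeasure_restrict_space)
  let ?S = "\<lambda>n. simple_process (m n) (\<tau> n) (\<eta> n)"
  let ?I = "\<lambda>n. simple_integral (m n) (\<tau> n) (\<eta> n)"
  let ?E = "\<lambda>n. simple_energy (m n) (\<tau> n) (\<eta> n)"
  define X where "X n \<omega> = (\<integral>\<^sup>+s. ennreal ((norm (H s \<omega> - ?S n s \<omega>))\<^sup>2) \<partial>N)" for n \<omega>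
  define Y where "Y n \<omega> = ennreal ((I \<omega> - ?I n \<omega>)\<^sup>2)" for n \<omega>

  \<comment> \<open>The identity map transports the joint measurability of \<open>H\<close> from the
    augmented sigma-algebra at time \<open>u\<close> to the larger completion.\<close>
  have idm: "(\<lambda>\<omega>. \<omega>) \<in> completion P \<rightarrow>\<^sub>M aug_filt T P u"
    by (rule measurable_aug_filt_completion[OF W u(2)]) simp
  have "(\<lambda>(s, \<omega>). H s \<omega>) \<in> borel_measurable (restrict_space borel {0..u} \<Otimes>\<^sub>M aug_filt T P u)"
    using I u by (auto simp: is_ito_integral_def progressive_def)
  then have "(\<lambda>(s, \<omega>). H s \<omega>) \<in> borel_measurable (N \<Otimes>\<^sub>M aug_filt T P u)"
    by (simp cong: measurable_cong_sets sets_pair_measure_cong add: setsN)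
  moreover have "(\<lambda>p. (snd p, fst p)) \<in> completion P \<Otimes>\<^sub>M N \<rightarrow>\<^sub>M N \<Otimes>\<^sub>M aug_filt T P u"
    using idm by measurable
  ultimately have Hm: "(\<lambda>p. H (snd p) (fst p)) \<in> borel_measurable (completion P \<Otimes>\<^sub>M N)"
    using measurable_compose[of "\<lambda>p. (snd p, fst p)" _ _ "\<lambda>(s, \<omega>). H s \<omega>"] by simp
  have H_section [measurable]: "(\<lambda>s. H s \<omega>) \<in> borel_measurable N" if "\<omega> \<in> path_space T" for \<omega>
    using measurable_compose[OF measurable_Pair1'[of \<omega> "completion P" N] Hm] that sp by simp
  have idN [measurable]: "(\<lambda>s. s) \<in> borel_measurable N"
    by (simp add: N_def measurable_restrict_space1)
  have \<eta>m: "\<eta> n k \<in> borel_measurable (completion P)" if "k < m n" for n k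
    using D[of n] that simple_data_times[OF D[of n], of k] u
    by (intro measurable_aug_filt_completion[OF W, of "\<tau> n k"]) (auto simp: simple_data_def)
  have Sm: "(\<lambda>p. ?S n (snd p) (fst p)) \<in> borel_measurable (completion P \<Otimes>\<^sub>M N)" for n
    unfolding simple_process_def
  proof (intro borel_measurable_sum borel_measurable_scaleR)
    fix k assume "k \<in> {..<m n}"
    then show "(\<lambda>p. \<eta> n k (fst p)) \<in> borel_measurable (completion P \<Otimes>\<^sub>M N)"
      using measurable_compose[OF measurable_fst \<eta>m] by simp
    show "(\<lambda>p. indicator {\<tau> n k<..\<tau> n (Suc k)} (snd p) :: real) \<in> borel_measurable (completion P \<Otimes>\<^sub>M N)"
      by measurable
  qed
  have S_section [measurable]: "(\<lambda>s. ?S n s \<omega>) \<in> borel_measurable N" for n \<omega>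
    unfolding simple_process_def by measurable
  have [measurable]: "X n \<in> borel_measurable (completion P)" for n
    unfolding X_def[abs_def]
  proof (rule N.borel_measurable_nn_integral)
    show "(\<lambda>(\<omega>, s). ennreal ((norm (H s \<omega> - ?S n s \<omega>))\<^sup>2)) \<in> borel_measurable (completion P \<Otimes>\<^sub>M N)"
      using Hm Sm[of n] unfolding case_prod_beta by measurable
  qed
  have Im [measurable]: "I \<in> borel_measurable (completion P)"
    using I u by (auto simp: is_ito_integral_def intro: measurable_aug_filt_completion[OF W])
  have Inm [measurable]: "?I n \<in> borel_measurable (completion P)"
    and Enm [measurable]: "?E n \<in> borel_measurable (completion P)" for n
    using simple_integral_measurable[OF W D[of n]] simple_energy_measurable[OF W D[of n]]
      simple_data_times[OF D[of n], of "m n"] u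
    by (auto intro: measurable_aug_filt_completion[OF W, of "\<tau> n (m n)"])
  have [measurable]: "Y n \<in> borel_measurable (completion P)" for n
    unfolding Y_def[abs_def] by measurable
  have add: "(\<integral>\<^sup>+\<omega>. X n \<omega> + Y n \<omega> \<partial>completion P)
      = (\<integral>\<^sup>+\<omega>. X n \<omega> \<partial>completion P) + (\<integral>\<^sup>+\<omega>. Y n \<omega> \<partial>completion P)" for n
    by (rule nn_integral_add) measurable
  \<comment> \<open>Adding the two errors lets a single choice of indices \<open>r\<close> serve
    both limits.\<close>
  have "(\<lambda>n. \<integral>\<^sup>+\<omega>. X n \<omega> + Y n \<omega> \<partial>completion P) \<longlonglongrightarrow> 0"
    unfolding add using tendsto_add[OF limH limI] by (simp add: X_def[abs_def] Y_def[abs_def] N)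
  then obtain r where r: "AE \<omega> in completion P. (\<lambda>n. X (r n) \<omega> + Y (r n) \<omega>) \<longlonglongrightarrow> 0"
    using nn_integral_tendsto_0_AE_subseq[of "\<lambda>n \<omega>. X n \<omega> + Y n \<omega>" "completion P"] by auto

  \<comment> \<open>The triangle inequality gives \<open>|S| \<le> C + |H - S|\<close>; squaring
    with \<open>(x + y)^2 \<le> 2 x^2 + 2 y^2\<close> and integrating over time gives the claim. The
    factor 2 is why the final exponent is \<open>C^2 * u\<close> and not half of it.\<close>
  have energy: "ennreal (?E n \<omega>) \<le> ennreal (2 * C\<^sup>2 * u) + 2 * X n \<omega>" if \<omega>: "\<omega> \<in> path_space T" for n \<omega>
  proof -
    have "ennreal ((norm (?S n s \<omega>))\<^sup>2)
        \<le> ennreal (2 * C\<^sup>2) + 2 * ennreal ((norm (H s \<omega> - ?S n s \<omega>))\<^sup>2)" if "s \<in> space N" for s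
    proof -
      have "norm (H s \<omega>) \<le> C" using C that \<omega> spN by auto
      moreover have "norm (?S n s \<omega>) \<le> norm (H s \<omega>) + norm (H s \<omega> - ?S n s \<omega>)"
        by (metis norm_minus_commute norm_triangle_sub)
      ultimately have "(norm (?S n s \<omega>))\<^sup>2 \<le> (C + norm (H s \<omega> - ?S n s \<omega>))\<^sup>2"
        by (intro power_mono) auto
      also have "\<dots> \<le> 2 * C\<^sup>2 + 2 * (norm (H s \<omega> - ?S n s \<omega>))\<^sup>2"
        using sum_squares_bound[of C "norm (H s \<omega> - ?S n s \<omega>)"] by (simp add: power2_sum)
      finally show ?thesis
        by (simp add: ennreal_plus[symmetric] ennreal_mult[symmetric] ennreal_numeral[symmetric]
            del: ennreal_plus ennreal_numeral)
    qed
    then have "(\<integral>\<^sup>+s. ennreal ((norm (?S n s \<omega>))\<^sup>2) \<partial>N)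
        \<le> (\<integral>\<^sup>+s. ennreal (2 * C\<^sup>2) + 2 * ennreal ((norm (H s \<omega> - ?S n s \<omega>))\<^sup>2) \<partial>N)"
      by (rule nn_integral_mono)
    also have "\<dots> = (\<integral>\<^sup>+s. ennreal (2 * C\<^sup>2) \<partial>N) + 2 * X n \<omega>"
      using H_section[OF \<omega>] unfolding X_def by (simp add: nn_integral_add nn_integral_cmult)
    also have "(\<integral>\<^sup>+s. ennreal (2 * C\<^sup>2) \<partial>N) = ennreal (2 * C\<^sup>2 * u)"
      using u by (simp add: emN ennreal_mult)
    finally show ?thesis by (simp add: nn_integral_simple_process_square[OF D] N[symmetric])
  qed

  \<comment> \<open>Half the energy is at most \<open>C^2 * u\<close> plus the error
    \<open>X\<close>, so the prefactor absorbs it: \<open>?V\<close> dominates the exponential of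
    \<open>?I\<close> minus the error. At the same time its expectation is the same constant for
    every \<open>n\<close>.\<close>
  let ?V = "\<lambda>n \<omega>. ennreal (exp (C\<^sup>2 * u)) * ennreal (exp (?I n \<omega> - ?E n \<omega> / 2))"
  have "AE \<omega> in completion P. ennreal (exp (I \<omega>)) \<le> liminf (\<lambda>n. ?V (r n) \<omega>)"
    using r AE_space
  proof eventually_elim
    case (elim \<omega>)
    then have \<omega>: "\<omega> \<in> path_space T" using sp by simp
    have X0: "(\<lambda>n. X (r n) \<omega>) \<longlonglongrightarrow> 0" and Y0: "(\<lambda>n. Y (r n) \<omega>) \<longlonglongrightarrow> 0"
      using elim(1) by (auto intro!: tendsto_sandwich[OF _ _ tendsto_const elim(1)] always_eventually)
    have "(\<lambda>n. (I \<omega> - ?I (r n) \<omega>)\<^sup>2) \<longlonglongrightarrow> 0"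
      using Y0 unfolding Y_def by (intro tendsto_ennrealD) auto
    from tendsto_real_sqrt[OF this] have "(\<lambda>n. I \<omega> - ?I (r n) \<omega>) \<longlonglongrightarrow> 0"
      by (simp add: tendsto_rabs_zero_iff)
    from tendsto_diff[OF tendsto_const[of "I \<omega>"] this]
    have I0: "(\<lambda>n. ?I (r n) \<omega>) \<longlonglongrightarrow> I \<omega>" by simp
    have x0: "(\<lambda>n. enn2real (X (r n) \<omega>)) \<longlonglongrightarrow> 0"
      by (rule tendsto_enn2real) (use X0 in auto)
    \<comment> \<open>\<open>enn2real\<close> sends infinity to 0, so it represents the error
      faithfully only where the error is finite; being below 1 ensures this.\<close>
    have "eventually (\<lambda>n. X (r n) \<omega> < 1) sequentially"
      by (rule order_tendstoD(2)[OF X0]) simp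
    then have le: "eventually (\<lambda>n. ennreal (exp (?I (r n) \<omega> - enn2real (X (r n) \<omega>))) \<le> ?V (r n) \<omega>) sequentially"
    proof eventually_elim
      case (elim n)
      define x where "x = enn2real (X (r n) \<omega>)"
      have x: "X (r n) \<omega> = ennreal x" "0 \<le> x"
        using elim unfolding x_def by (auto intro!: ennreal_enn2real[symmetric] simp: less_top[symmetric] dest: less_trans[of _ 1 top])
      have "ennreal (?E (r n) \<omega>) \<le> ennreal (2 * C\<^sup>2 * u + 2 * x)"
        using energy[OF \<omega>, of "r n"] x u
        by (simp add: ennreal_plus[symmetric] ennreal_mult[symmetric] ennreal_numeral[symmetric]
            del: ennreal_plus ennreal_numeral)
      then have "?E (r n) \<omega> \<le> 2 * C\<^sup>2 * u + 2 * x"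
        using x u by (subst (asm) ennreal_le_iff) auto
      then show ?case
        by (simp add: x_def[symmetric] ennreal_mult[symmetric] exp_add[symmetric])
    qed
    have "(\<lambda>n. ennreal (exp (?I (r n) \<omega> - enn2real (X (r n) \<omega>)))) \<longlonglongrightarrow> ennreal (exp (I \<omega> - 0))"
      using I0 x0 by (intro tendsto_ennrealI tendsto_exp tendsto_diff)
    from lim_imp_Liminf[OF _ this] have "ennreal (exp (I \<omega>)) = liminf (\<lambda>n. ennreal (exp (?I (r n) \<omega> - enn2real (X (r n) \<omega>))))"
      by simp
    also have "\<dots> \<le> liminf (\<lambda>n. ?V (r n) \<omega>)" by (rule Liminf_mono[OF le])
    finally show ?case .
  qed
  then have "(\<integral>\<^sup>+\<omega>. ennreal (exp (I \<omega>)) \<partial>completion P)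
      \<le> (\<integral>\<^sup>+\<omega>. liminf (\<lambda>n. ?V (r n) \<omega>) \<partial>completion P)"
    by (rule nn_integral_mono_AE)
  also have "\<dots> \<le> liminf (\<lambda>n. \<integral>\<^sup>+\<omega>. ?V (r n) \<omega> \<partial>completion P)"
    by (rule nn_integral_liminf) measurable
  also have "\<dots> = ennreal (exp (C\<^sup>2 * u))"
    using nn_integral_simple_exponential[OF W D u(2)]
    by (simp add: nn_integral_cmult Liminf_const)
  finally show ?thesis .
qed

section \<open>A bound on the costs that is uniform over the controls\<close>

lemma concat_path_in_path_space:
  assumes t: "t \<in> {0..T}" and \<omega>: "\<omega> \<in> path_space T" and \<omega>': "\<omega>' \<in> path_space T"
  shows "concat_path T t \<omega> \<omega>' \<in> path_space T"
proof -
  have c: "continuous_on {0..T} \<omega>" "continuous_on {0..T} \<omega>'" "\<omega> 0 = 0" "\<omega>' 0 = 0"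
    using \<omega> \<omega>' by (auto simp: path_space_def)
  \<comment> \<open>The two branches agree at \<open>s = t\<close> because the attached path starts
    at 0.\<close>
  have "continuous_on ({0..t} \<union> {t..T}) (\<lambda>s. if s \<le> t then \<omega> s else \<omega> t + \<omega>' (s - t))"
  proof (rule continuous_on_If)
    show "continuous_on {0..t} \<omega>" using c(1) t by (rule_tac continuous_on_subset) auto
    have "continuous_on {t..T} (\<lambda>s. \<omega>' (s - t))"
      using t by (intro continuous_on_compose2[OF c(2)] continuous_intros) auto
    then show "continuous_on {t..T} (\<lambda>s. \<omega> t + \<omega>' (s - t))" by (intro continuous_intros)
  qed (use c t in auto)
  moreover have "{0..t} \<union> {t..T} = {0..T}" using t by auto
  ultimately have "continuous_on {0..T} (concat_path T t \<omega> \<omega>')"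
    by (intro continuous_on_eq[where g = "concat_path T t \<omega> \<omega>'"]) (auto simp: concat_path_def)
  then show ?thesis using t c by (auto simp: path_space_def concat_path_def)
qed

text \<open>No measurability of \<open>g\<close> is assumed: \<^const>\<open>density\<close> takes the value 0 wherever the integral
  fails to define a measure.\<close>
lemma emeasure_density_space_le: "emeasure (density M g) (space M) \<le> (\<integral>\<^sup>+x. g x \<partial>M)"
proof -
  have "(\<integral>\<^sup>+x. g x * indicator (space M) x \<partial>M) = (\<integral>\<^sup>+x. g x \<partial>M)"
    by (intro nn_integral_cong) simp
  then show ?thesis unfolding density_def by (subst emeasure_measure_of_conv) auto
qed

text \<open>A function that is not integrable has integral 0 by convention, and
  \<open>0 \<le> K\<close> covers that case. The estimate thus applies to shifted data that may have
  lost their measurability.\<close>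

lemma norm_integral_le:
  fixes g :: "'a \<Rightarrow> 'b::{banach, second_countable_topology}"
  assumes "0 \<le> K" and "(\<integral>\<^sup>+x. ennreal (norm (g x)) \<partial>M) \<le> ennreal K"
  shows "norm (integral\<^sup>L M g) \<le> K"
proof (cases "integrable M g")
  case True
  from order_trans[OF integral_norm_bound_ennreal[OF this] assms(2)] show ?thesis
    using assms(1) by simp
qed (use assms in \<open>simp add: not_integrable_integral_eq\<close>)

lemma shift_coeff_bound:
  assumes t: "t \<in> {0..T}" and \<omega>: "\<omega> \<in> path_space T" and \<alpha>: "\<alpha> \<in> controls T P A"
    and C: "\<And>s w a. s \<in> {0..T} \<Longrightarrow> w \<in> path_space T \<Longrightarrow> a \<in> action_profiles A \<Longrightarrow> norm (g s w a) \<le> C"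
    and s: "s \<in> {0..T - t}" and \<omega>': "\<omega>' \<in> path_space T"
  shows "norm (shift_coeff T t \<omega> g s \<omega>' (profile_at \<alpha> s \<omega>')) \<le> C"
  unfolding shift_coeff_def
proof (rule C)
  show "t + s \<in> {0..T}" using t s by auto
  show "concat_path T t \<omega> \<omega>' \<in> path_space T"
    using t \<omega> \<omega>' by (rule concat_path_in_path_space)
  show "profile_at \<alpha> s \<omega>' \<in> action_profiles A"
    using \<alpha> s t \<omega>' by (auto simp: controls_def player_controls_def action_profiles_def profile_at_def)
qed

lemma controlled_measure_mass:
  fixes P :: "('d::finite) path measure" and A :: "'n::finite \<Rightarrow> 'a::euclidean_space set"
  assumes W: "wiener_measure T P" and t: "t \<in> {0..T}" and \<omega>: "\<omega> \<in> path_space T"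
    and \<alpha>: "\<alpha> \<in> controls T P A"
    and C: "\<And>s w a. s \<in> {0..T} \<Longrightarrow> w \<in> path_space T \<Longrightarrow> a \<in> action_profiles A \<Longrightarrow> norm (b s w a) \<le> C"
  shows "emeasure (controlled_measure T P b t \<omega> \<alpha>) (path_space T) \<le> ennreal (exp (C\<^sup>2 * (T - t)))"
proof -
  interpret cP: prob_space "completion P" by (rule wiener_measure_prob_space_completion[OF W])
  define H where "H = (\<lambda>s \<omega>'. shift_coeff T t \<omega> b s \<omega>' (profile_at \<alpha> s \<omega>'))"
  define I where "I = ito_integral T P (T - t) H"
  have HC: "norm (H s \<omega>') \<le> C" if "s \<in> {0..T - t}" "\<omega>' \<in> path_space T" for s \<omega>'
    unfolding H_def using shift_coeff_bound[OF t \<omega> \<alpha> C that] .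
  have "emeasure (controlled_measure T P b t \<omega> \<alpha>) (path_space T)
    \<le> (\<integral>\<^sup>+\<omega>'. ennreal (exp (I \<omega>' - 1 / 2 * (LINT s:{0..T - t}|lborel. (norm (H s \<omega>'))\<^sup>2))) \<partial>completion P)"
    using emeasure_density_space_le[of "completion P"] space_wiener_measure[OF W]
    by (simp add: controlled_measure_def H_def[symmetric] I_def Let_def)
  \<comment> \<open>The energy is nonnegative, also when its integral takes the default value 0, so
    dropping it only enlarges the density.\<close>
  also have "\<dots> \<le> (\<integral>\<^sup>+\<omega>'. ennreal (exp (I \<omega>')) \<partial>completion P)"
    by (intro nn_integral_mono) (auto intro!: ennreal_leI integral_nonneg simp: set_lebesgue_integral_def)
  also have "\<dots> \<le> ennreal (exp (C\<^sup>2 * (T - t)))"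
  \<comment> \<open>If an integral exists, \<open>ito_integral\<close> is one of its versions and
    the exponential bound applies. Otherwise it is 0, and the bound needed is just
    \<open>1 \<le> exp (C^2 * (T - t))\<close>.\<close>
  proof (cases "\<exists>I. is_ito_integral T P (T - t) H I")
    case True
    then have "is_ito_integral T P (T - t) H I"
      using someI_ex[OF True] by (simp add: I_def ito_integral_def)
    from ito_integral_exponential_bound[OF W _ _ this HC] show ?thesis using t by auto
  next
    case False
    then have "I = (\<lambda>_. 0)" by (simp add: I_def ito_integral_def)
    then have "(\<integral>\<^sup>+\<omega>'. ennreal (exp (I \<omega>')) \<partial>completion P) = ennreal 1"
      using cP.emeasure_space_1 by simp
    also have "\<dots> \<le> ennreal (exp (C\<^sup>2 * (T - t)))" using t by (intro ennreal_leI) simp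
    finally show ?thesis .
  qed
  finally show ?thesis .
qed

text \<open>The payoff along each path is at most \<open>C\<xi> + Cf * (T - t)\<close>. The
  controlled measure is treated only as a measure of bounded mass, which contributes the exponential
  factor. Neither quantity depends on \<open>\<alpha>\<close>.\<close>

lemma cost_bound:
  fixes P :: "('d::finite) path measure" and A :: "'n::finite \<Rightarrow> 'a::euclidean_space set"
  assumes W: "wiener_measure T P" and t: "t \<in> {0..T}" and \<omega>: "\<omega> \<in> path_space T"
    and \<alpha>: "\<alpha> \<in> controls T P A"
    and b: "\<And>s w a. s \<in> {0..T} \<Longrightarrow> w \<in> path_space T \<Longrightarrow> a \<in> action_profiles A \<Longrightarrow> norm (b s w a) \<le> Cb"
    and f: "\<And>s w a. s \<in> {0..T} \<Longrightarrow> w \<in> path_space T \<Longrightarrow> a \<in> action_profiles A \<Longrightarrow> norm (f s w a) \<le> Cf"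
    and \<xi>: "\<And>w. w \<in> path_space T \<Longrightarrow> norm (\<xi> w) \<le> C\<xi>"
    and nn: "0 \<le> Cf" "0 \<le> C\<xi>"
  shows "\<bar>cost T P b f \<xi> t \<omega> \<alpha> $ i\<bar> \<le> (C\<xi> + Cf * (T - t)) * exp (Cb\<^sup>2 * (T - t))"
proof -
  let ?M = "controlled_measure T P b t \<omega> \<alpha>"
  let ?g = "\<lambda>\<omega>'. shift_rv T t \<omega> \<xi> \<omega>' $ i
    + (LINT s:{0..T - t}|lborel. shift_coeff T t \<omega> f s \<omega>' (profile_at \<alpha> s \<omega>') $ i)"
  have K: "0 \<le> C\<xi> + Cf * (T - t)" using nn t by simp
  have sp: "space ?M = path_space T"
    using space_wiener_measure[OF W] by (simp add: controlled_measure_def Let_def)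
  have g: "norm (?g \<omega>') \<le> C\<xi> + Cf * (T - t)" if \<omega>': "\<omega>' \<in> path_space T" for \<omega>'
  proof -
    have "norm (shift_rv T t \<omega> \<xi> \<omega>' $ i) \<le> C\<xi>"
      unfolding shift_rv_def
      using component_le_norm_cart \<xi>[OF concat_path_in_path_space[OF t \<omega> \<omega>']]
      by (auto intro: order_trans)
    moreover have "norm (LINT s:{0..T - t}|lborel. shift_coeff T t \<omega> f s \<omega>' (profile_at \<alpha> s \<omega>') $ i)
        \<le> Cf * (T - t)"
      unfolding set_lebesgue_integral_def
    proof (rule norm_integral_le)
      show "0 \<le> Cf * (T - t)" using nn t by simp
      have "(\<integral>\<^sup>+s. ennreal (norm (indicator {0..T - t} s *\<^sub>R
            shift_coeff T t \<omega> f s \<omega>' (profile_at \<alpha> s \<omega>') $ i)) \<partial>lborel)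
          \<le> (\<integral>\<^sup>+s. ennreal Cf * indicator {0..T - t} s \<partial>lborel)"
      proof (intro nn_integral_mono)
        fix s
        show "ennreal (norm (indicator {0..T - t} s *\<^sub>R
            shift_coeff T t \<omega> f s \<omega>' (profile_at \<alpha> s \<omega>') $ i)) \<le> ennreal Cf * indicator {0..T - t} s"
          using order_trans[OF component_le_norm_cart shift_coeff_bound[OF t \<omega> \<alpha> f _ \<omega>']]
          by (cases "s \<in> {0..T - t}") (auto intro!: ennreal_leI)
      qed
      also have "\<dots> = ennreal (Cf * (T - t))"
        using t nn by (simp add: nn_integral_cmult ennreal_mult)
      finally show "(\<integral>\<^sup>+s. ennreal (norm (indicator {0..T - t} s *\<^sub>R
            shift_coeff T t \<omega> f s \<omega>' (profile_at \<alpha> s \<omega>') $ i)) \<partial>lborel) \<le> ennreal (Cf * (T - t))" .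
    qed
    ultimately show ?thesis by (intro norm_triangle_mono)
  qed
  have "norm (integral\<^sup>L ?M ?g) \<le> (C\<xi> + Cf * (T - t)) * exp (Cb\<^sup>2 * (T - t))"
  proof (rule norm_integral_le)
    show "0 \<le> (C\<xi> + Cf * (T - t)) * exp (Cb\<^sup>2 * (T - t))" using K by simp
    have "(\<integral>\<^sup>+\<omega>'. ennreal (norm (?g \<omega>')) \<partial>?M) \<le> (\<integral>\<^sup>+\<omega>'. ennreal (C\<xi> + Cf * (T - t)) \<partial>?M)"
      using g sp by (intro nn_integral_mono ennreal_leI) auto
    also have "\<dots> \<le> ennreal (C\<xi> + Cf * (T - t)) * ennreal (exp (Cb\<^sup>2 * (T - t)))"
      using controlled_measure_mass[OF W t \<omega> \<alpha> b] by (simp add: sp mult_left_mono)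
    finally show "(\<integral>\<^sup>+\<omega>'. ennreal (norm (?g \<omega>')) \<partial>?M)
        \<le> ennreal ((C\<xi> + Cf * (T - t)) * exp (Cb\<^sup>2 * (T - t)))"
      using K by (simp add: ennreal_mult)
  qed
  then show ?thesis by (simp add: cost_def)
qed

section \<open>Topology of the value sets\<close>

lemma open_value_set_eps: "open (value_set_eps T P A b f \<xi> \<epsilon> t \<omega>)"
  by (auto simp: value_set_eps_def)

text \<open>A limit point lies within \<open>\<epsilon> - \<epsilon>'\<close> of some point of a
  ball of radius \<open>\<epsilon>'\<close>, hence in the concentric ball of radius
  \<open>\<epsilon>\<close>. The centre stays admissible, since weakening the tolerance keeps
  equilibria.\<close>

lemma closure_value_set_eps_subset:
  assumes "\<epsilon>' < \<epsilon>"
  shows "closure (value_set_eps T P A b f \<xi> \<epsilon>' t \<omega>) \<subseteq> value_set_eps T P A b f \<xi> \<epsilon> t \<omega>"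
proof
  fix y assume "y \<in> closure (value_set_eps T P A b f \<xi> \<epsilon>' t \<omega>)"
  then obtain z where z: "z \<in> value_set_eps T P A b f \<xi> \<epsilon>' t \<omega>" "dist z y < \<epsilon> - \<epsilon>'"
    using assms unfolding closure_approachable by (meson diff_gt_0_iff_gt)
  then obtain \<alpha> where \<alpha>: "\<alpha> \<in> eps_equilibria T P A b f \<xi> \<epsilon>' t \<omega>" "dist (cost T P b f \<xi> t \<omega> \<alpha>) z < \<epsilon>'"
    by (auto simp: value_set_eps_def)
  have "\<alpha> \<in> eps_equilibria T P A b f \<xi> \<epsilon> t \<omega>"
    using \<alpha>(1) assms by (fastforce simp: eps_equilibria_def)
  moreover have "dist (cost T P b f \<xi> t \<omega> \<alpha>) y < \<epsilon>"
    using z(2) \<alpha>(2) dist_triangle[of "cost T P b f \<xi> t \<omega> \<alpha>" y z] by simp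
  ultimately show "y \<in> value_set_eps T P A b f \<xi> \<epsilon> t \<omega>"
    by (auto simp: value_set_eps_def)
qed

lemma value_set_eps_mono:
  assumes "\<epsilon>' \<le> \<epsilon>"
  shows "value_set_eps T P A b f \<xi> \<epsilon>' t \<omega> \<subseteq> value_set_eps T P A b f \<xi> \<epsilon> t \<omega>"
  using assms closure_subset closure_value_set_eps_subset[of \<epsilon>' \<epsilon>] by (cases "\<epsilon>' = \<epsilon>") fastforce+

text \<open>The closure at level \<open>\<epsilon> / 2\<close> already lies in the open set at level
  \<open>\<epsilon>\<close>, so taking closures does not enlarge the intersection. Closedness of the
  value set becomes evident in this form.\<close>

lemma value_set_eq_Inter_closure:
  "value_set T P A b f \<xi> t \<omega> = (\<Inter>\<epsilon>\<in>{0<..}. closure (value_set_eps T P A b f \<xi> \<epsilon> t \<omega>))"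
proof
  show "value_set T P A b f \<xi> t \<omega> \<subseteq> (\<Inter>\<epsilon>\<in>{0<..}. closure (value_set_eps T P A b f \<xi> \<epsilon> t \<omega>))"
    using closure_subset by (fastforce simp: value_set_def)
  show "(\<Inter>\<epsilon>\<in>{0<..}. closure (value_set_eps T P A b f \<xi> \<epsilon> t \<omega>)) \<subseteq> value_set T P A b f \<xi> t \<omega>"
    unfolding value_set_def
  proof (rule INF_mono)
    fix \<epsilon> :: real assume "\<epsilon> \<in> {0<..}"
    then show "\<exists>\<epsilon>'\<in>{0<..}. closure (value_set_eps T P A b f \<xi> \<epsilon>' t \<omega>) \<subseteq> value_set_eps T P A b f \<xi> \<epsilon> t \<omega>"
      by (intro bexI[of _ "\<epsilon> / 2"] closure_value_set_eps_subset) auto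
  qed
qed

text \<open>Cantor's intersection theorem: along \<open>\<epsilon> = 1 / (n + 1)\<close> the
  closures are nonempty, compact and decreasing.\<close>

lemma value_set_nonempty:
  assumes bdd: "\<And>\<epsilon>. 0 < \<epsilon> \<Longrightarrow> bounded (value_set_eps T P A b f \<xi> \<epsilon> t \<omega>)"
    and ne: "\<And>\<epsilon>. 0 < \<epsilon> \<Longrightarrow> eps_equilibria T P A b f \<xi> \<epsilon> t \<omega> \<noteq> {}"
  shows "value_set T P A b f \<xi> t \<omega> \<noteq> {}"
proof -
  let ?V = "\<lambda>\<epsilon>. value_set_eps T P A b f \<xi> \<epsilon> t \<omega>"
  have "?V \<epsilon> \<noteq> {}" if "0 < \<epsilon>" for \<epsilon>
    using ne[OF that] that by (auto simp: value_set_eps_def ball_eq_empty)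
  then have "(\<Inter>n. closure (?V (inverse (real (Suc n))))) \<noteq> {}"
  proof (intro compact_nest)
    fix i j :: nat assume "i \<le> j"
    then show "closure (?V (inverse (real (Suc j)))) \<subseteq> closure (?V (inverse (real (Suc i))))"
      by (intro closure_mono value_set_eps_mono le_imp_inverse_le) auto
  qed (use bdd in auto)
  then obtain y where y: "\<And>n. y \<in> closure (?V (inverse (real (Suc n))))" by auto
  \<comment> \<open>The levels \<open>1 / (n + 1)\<close> fall below every positive
    \<open>\<epsilon>\<close>, so monotonicity extends membership from the sequence to all
    levels.\<close>
  have "y \<in> closure (?V \<epsilon>)" if \<epsilon>: "0 < \<epsilon>" for \<epsilon>
  proof -
    obtain n where "inverse (real (Suc n)) < \<epsilon>" using reals_Archimedean[OF \<epsilon>] by auto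
    then show ?thesis using y[of n] closure_mono[OF value_set_eps_mono] by (meson less_imp_le subsetD)
  qed
  then show ?thesis unfolding value_set_eq_Inter_closure by auto
qed

theorem proposition3p4:
  fixes T :: real and P :: "('d::finite) path measure"
    and A :: "'n::finite \<Rightarrow> 'a::euclidean_space set"
    and b :: "real \<Rightarrow> 'd path \<Rightarrow> 'a ^ 'n \<Rightarrow> real ^ 'd"
    and f :: "real \<Rightarrow> 'd path \<Rightarrow> 'a ^ 'n \<Rightarrow> real ^ 'n"
    and \<xi> :: "'d path \<Rightarrow> real ^ 'n"
    and t :: real and \<omega> :: "'d path"
  assumes "T > 0" and "wiener_measure T P"
    and "convex (action_profiles A)" and "action_profiles A \<noteq> {}"
    and "\<And>s w a a' i. s \<in> {0..T} \<Longrightarrow> w \<in> path_space T \<Longrightarrow> a \<in> action_profiles A \<Longrightarrow>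
           a' \<in> action_profiles A \<Longrightarrow> a $ i = a' $ i \<Longrightarrow> f s w a $ i = f s w a' $ i"
    and "progressive_param T (aug_filt T P) (action_profiles A) borel b"
    and "progressive_param T (aug_filt T P) (action_profiles A) borel f"
    and "\<xi> \<in> borel_measurable (aug_filt T P T)"
    and "\<exists>C. \<forall>s\<in>{0..T}. \<forall>w\<in>path_space T. \<forall>a\<in>action_profiles A. norm (b s w a) \<le> C"
    and "\<exists>C. \<forall>s\<in>{0..T}. \<forall>w\<in>path_space T. \<forall>a\<in>action_profiles A. norm (f s w a) \<le> C"
    and "\<exists>C. \<forall>w\<in>path_space T. norm (\<xi> w) \<le> C"
    and "t \<in> {0..T}" and "\<omega> \<in> path_space T"
  shows "(\<forall>\<epsilon>>0. bounded (value_set_eps T P A b f \<xi> \<epsilon> t \<omega>) \<and>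
                open (value_set_eps T P A b f \<xi> \<epsilon> t \<omega>)) \<and>
         (\<forall>\<epsilon>' \<epsilon>. 0 < \<epsilon>' \<and> \<epsilon>' < \<epsilon> \<longrightarrow>
            closure (value_set_eps T P A b f \<xi> \<epsilon>' t \<omega>) \<subseteq> value_set_eps T P A b f \<xi> \<epsilon> t \<omega>) \<and>
         compact (value_set T P A b f \<xi> t \<omega>) \<and>
         ((\<forall>\<epsilon>>0. eps_equilibria T P A b f \<xi> \<epsilon> t \<omega> \<noteq> {}) \<longrightarrow> value_set T P A b f \<xi> t \<omega> \<noteq> {})"
proof -
  obtain Cb where Cb: "\<And>s w a. s \<in> {0..T} \<Longrightarrow> w \<in> path_space T \<Longrightarrow> a \<in> action_profiles A \<Longrightarrow> norm (b s w a) \<le> Cb"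
    using assms(9) by blast
  obtain Cf' where Cf': "\<And>s w a. s \<in> {0..T} \<Longrightarrow> w \<in> path_space T \<Longrightarrow> a \<in> action_profiles A \<Longrightarrow> norm (f s w a) \<le> Cf'"
    using assms(10) by blast
  obtain C\<xi>' where C\<xi>': "\<And>w. w \<in> path_space T \<Longrightarrow> norm (\<xi> w) \<le> C\<xi>'" using assms(11) by blast
  \<comment> \<open>The bounds obtained from the hypotheses carry no sign, while
    \<open>cost_bound\<close> asks for nonnegative \<open>Cf\<close> and \<open>C\<xi>\<close>;
    \<open>Cb\<close> occurs there only squared.\<close>
  define Cf C\<xi> where "Cf = \<bar>Cf'\<bar>" and "C\<xi> = \<bar>C\<xi>'\<bar>"
  have Cf: "norm (f s w a) \<le> Cf" if "s \<in> {0..T}" "w \<in> path_space T" "a \<in> action_profiles A" for s w a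
    using Cf'[OF that] by (simp add: Cf_def)
  have C\<xi>: "norm (\<xi> w) \<le> C\<xi>" if "w \<in> path_space T" for w using C\<xi>'[OF that] by (simp add: C\<xi>_def)
  define K where "K = (C\<xi> + Cf * (T - t)) * exp (Cb\<^sup>2 * (T - t))"
  have cost: "norm (cost T P b f \<xi> t \<omega> \<alpha>) \<le> real CARD('n) * K" if "\<alpha> \<in> controls T P A" for \<alpha>
  proof -
    \<comment> \<open>Passing from components to the Euclidean norm through the sum norm costs the
      factor \<open>CARD('n)\<close>.\<close>
    have "norm (cost T P b f \<xi> t \<omega> \<alpha>) \<le> (\<Sum>i\<in>UNIV. \<bar>cost T P b f \<xi> t \<omega> \<alpha> $ i\<bar>)"
      by (rule norm_le_l1_cart)
    also have "\<dots> \<le> of_nat CARD('n) * K"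
      unfolding K_def
      using cost_bound[OF assms(2,12,13) that Cb Cf C\<xi>] by (intro sum_bounded_above) (auto simp: Cf_def C\<xi>_def)
    finally show ?thesis .
  qed
  have bdd: "bounded (value_set_eps T P A b f \<xi> \<epsilon> t \<omega>)" for \<epsilon>
    unfolding bounded_iff
  proof (intro exI ballI)
    fix y assume "y \<in> value_set_eps T P A b f \<xi> \<epsilon> t \<omega>"
    then obtain \<alpha> where "\<alpha> \<in> controls T P A" "dist (cost T P b f \<xi> t \<omega> \<alpha>) y < \<epsilon>"
      by (auto simp: value_set_eps_def eps_equilibria_def)
    then show "norm y \<le> real CARD('n) * K + \<epsilon>"
      using cost[of \<alpha>] norm_triangle_sub[of y "cost T P b f \<xi> t \<omega> \<alpha>"] by (simp add: dist_norm norm_minus_commute)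
  qed
  have "compact (value_set T P A b f \<xi> t \<omega>)"
    unfolding compact_eq_bounded_closed
  proof
    show "bounded (value_set T P A b f \<xi> t \<omega>)"
      \<comment> \<open>The intersection is contained in its member at level 1, which is
        bounded.\<close>
      by (rule bounded_subset[OF bdd[of 1]]) (auto simp: value_set_def)
    show "closed (value_set T P A b f \<xi> t \<omega>)"
      unfolding value_set_eq_Inter_closure by (intro closed_INT) auto
  qed
  then show ?thesis
    using bdd by (simp add: open_value_set_eps closure_value_set_eps_subset value_set_nonempty)
qed

end
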